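(* Let $\Phi=\{\varphi_1,\varphi_2,\varphi_3\}$ be the graphing on $[0,1]$ consisting of the partial isomorphisms $\varphi_1:[0,1/2]\to[0,3/4]$, $\varphi_1(x)=A^{-1}(x)$; $\varphi_2:[1/2,3/4]\to[1/2,7/8]$, $\varphi_2(x)=B^{-1}(x)$; $\varphi_3:[3/4,1]\to[1/2,1]$, $\varphi_3(x)=A(x)$. Then for every (nonempty) reduced word $\omega$ over $\Phi$ the set $\{x\in[0,1] : \omega(x)=x\}$ has Lebesgue measure zero; i.e. almost every orbit of the equivalence relation $R_\Phi$ generated by $\Phi$ has a tree structure.
   Context: $A$ and $B$ are the piecewise linear homeomorphisms of $[0,1]$ given by $$A(x)=\begin{cases} x/2, & 0\le x\le 1/2\\ x-1/4, & 1/2\le x\le 3/4\\ 2x-1, & 3/4\le x\le 1\end{cases}\qquad B(x)=\begin{cases} x, & 0\le x\le 1/2\\ x/2+1/4, & 1/2\le x\le 3/4\\ x-1/8, & 3/4\le x\le 7/8\\ 2x-1, & 7/8\le x\le 1.\end{cases}$$ They generate the Thompson group $F$. A graphing is a countable family $\Phi=(\varphi_i:A_i\to B_i)_{i\in I}$ of Borel partial isomorphisms between Borel subsets (not required to preserve the measure). $R_\Phi$ is the smallest equivalence relation containing all pairs $(x,\varphi_i(x))$ with $x\in A_i$, $i\in I$. A reduced word over $\Phi$ is an expression $\omega=\varphi_{i_1}^{\epsilon_1}\varphi_{i_2}^{\epsilon_2}\cdots\varphi_{i_k}^{\epsilon_k}$ with $k\ge1$, $i_j\in\{1,2,3\}$,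 $\epsilon_j\in\{-1,1\}$, such that $i_j=i_{j+1}$ implies $\epsilon_j=\epsilon_{j+1}$. It acts as a partially defined map by composition from right to left, where $\varphi_i$ is defined on its domain and $\varphi_i^{-1}$ on the image of $\varphi_i$; the equation $\omega(x)=x$ includes the requirement that $\omega(x)$ is defined. An orbit has a tree structure if the graph on it, whose edges join $x$ to $\varphi_i(x)$ for each $i$ and each $x\in A_i$ in the orbit, is a tree, i.e. no nonempty reduced word fixes a point of the orbit. *)

theory Defs
  imports "HOL-Analysis.Analysis"
begin

definition thompson_A :: "real \<Rightarrow> real" where
  "thompson_A x =
     (if x \<le> 1/2 then x/2
      else if x \<le> 3/4 then x - 1/4
      else 2*x - 1)"

definition thompson_B :: "real \<Rightarrow> real" where
  "thompson_B x =
     (if x \<le> 1/2 then x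
      else if x \<le> 3/4 then x/2 + 1/4
      else if x \<le> 7/8 then x - 1/8
      else 2*x - 1)"

definition partial_inv :: "('a \<rightharpoonup> 'b) \<Rightarrow> ('b \<rightharpoonup> 'a)" where
  "partial_inv \<phi> y = (if y \<in> ran \<phi> then Some (THE x. \<phi> x = Some y) else None)"

definition borel_partial_iso ::
    "('a::topological_space) set \<Rightarrow> ('a \<rightharpoonup> 'a) \<Rightarrow> bool" where
  "borel_partial_iso X \<phi> \<longleftrightarrow>
     dom \<phi> \<in> sets borel \<and> dom \<phi> \<subseteq> X \<and>
     ran \<phi> \<in> sets borel \<and> ran \<phi> \<subseteq> X \<and>
     inj_on \<phi> (dom \<phi>) \<and>
     (\<lambda>x. the (\<phi> x)) \<in> restrict_space borel (dom \<phi>) \<rightarrow>\<^sub>M borel \<and>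
     (\<lambda>y. the (partial_inv \<phi> y)) \<in> restrict_space borel (ran \<phi>) \<rightarrow>\<^sub>M borel"

definition graphing ::
    "('a::topological_space) set \<Rightarrow> 'i set \<Rightarrow> ('i \<Rightarrow> ('a \<rightharpoonup> 'a)) \<Rightarrow> bool" where
  "graphing X I \<Phi> \<longleftrightarrow> countable I \<and> (\<forall>i\<in>I. borel_partial_iso X (\<Phi> i))"

definition graphing_rel :: "'a set \<Rightarrow> 'i set \<Rightarrow> ('i \<Rightarrow> ('a \<rightharpoonup> 'a)) \<Rightarrow> ('a \<times> 'a) set" where
  "graphing_rel X I \<Phi> =
     \<Inter>{R. equiv X R \<and> (\<forall>i\<in>I. \<forall>x y. \<Phi> i x = Some y \<longrightarrow> (x, y) \<in> R)}"

definition graphing_orbit :: "'a set \<Rightarrow> 'i set \<Rightarrow> ('i \<Rightarrow> ('a \<rightharpoonup> 'a)) \<Rightarrow> 'a \<Rightarrow> 'a set" where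
  "graphing_orbit X I \<Phi> x = graphing_rel X I \<Phi> `` {x}"

text \<open>A letter \<open>(i, True)\<close> stands for \<open>\<phi>\<^sub>i\<close> and \<open>(i, False)\<close> for its inverse.\<close>

definition reduced_word :: "'i set \<Rightarrow> ('i \<times> bool) list \<Rightarrow> bool" where
  "reduced_word I w \<longleftrightarrow>
     w \<noteq> [] \<and> fst ` set w \<subseteq> I \<and>
     successively (\<lambda>k l. fst k = fst l \<longrightarrow> snd k = snd l) w"

definition letter_map :: "('i \<Rightarrow> ('a \<rightharpoonup> 'a)) \<Rightarrow> 'i \<times> bool \<Rightarrow> ('a \<rightharpoonup> 'a)" where
  "letter_map \<Phi> l = (if snd l then \<Phi> (fst l) else partial_inv (\<Phi> (fst l)))"

definition word_map :: "('i \<Rightarrow> ('a \<rightharpoonup> 'a)) \<Rightarrow> ('i \<times> bool) list \<Rightarrow> ('a \<rightharpoonup> 'a)" where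
  "word_map \<Phi> w = foldr (\<lambda>l f. letter_map \<Phi> l \<circ>\<^sub>m f) w Some"

text \<open>
  An undirected multigraph has vertices \<open>V\<close> and edges \<open>E\<close>, the edge \<open>a\<close> joining
  \<open>s a\<close> to \<open>t a\<close>. In a walk, \<open>(a, True)\<close> traverses \<open>a\<close> from \<open>s a\<close> to \<open>t a\<close> and
  \<open>(a, False)\<close> traverses it in the opposite direction. Loops and pairs of parallel edges are
  cycles, of length 1 and 2.
\<close>

definition step_start :: "('e \<Rightarrow> 'v) \<Rightarrow> ('e \<Rightarrow> 'v) \<Rightarrow> 'e \<times> bool \<Rightarrow> 'v" where
  "step_start s t p = (if snd p then s (fst p) else t (fst p))"

definition step_end :: "('e \<Rightarrow> 'v) \<Rightarrow> ('e \<Rightarrow> 'v) \<Rightarrow> 'e \<times> bool \<Rightarrow> 'v" where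
  "step_end s t p = (if snd p then t (fst p) else s (fst p))"

fun mg_walk ::
    "'e set \<Rightarrow> ('e \<Rightarrow> 'v) \<Rightarrow> ('e \<Rightarrow> 'v) \<Rightarrow> 'v \<Rightarrow> ('e \<times> bool) list \<Rightarrow> 'v \<Rightarrow> bool" where
  "mg_walk E s t u [] v \<longleftrightarrow> u = v"
| "mg_walk E s t u (p # ps) v \<longleftrightarrow>
     fst p \<in> E \<and> u = step_start s t p \<and> mg_walk E s t (step_end s t p) ps v"

definition mg_connected :: "'v set \<Rightarrow> 'e set \<Rightarrow> ('e \<Rightarrow> 'v) \<Rightarrow> ('e \<Rightarrow> 'v) \<Rightarrow> bool" where
  "mg_connected V E s t \<longleftrightarrow> V \<noteq> {} \<and> (\<forall>u\<in>V. \<forall>v\<in>V. \<exists>ps. mg_walk E s t u ps v)"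

definition mg_cycle ::
    "'e set \<Rightarrow> ('e \<Rightarrow> 'v) \<Rightarrow> ('e \<Rightarrow> 'v) \<Rightarrow> 'v \<Rightarrow> ('e \<times> bool) list \<Rightarrow> bool" where
  "mg_cycle E s t u ps \<longleftrightarrow>
     ps \<noteq> [] \<and> mg_walk E s t u ps u \<and>
     distinct (map (step_start s t) ps) \<and> distinct (map fst ps)"

definition mg_tree :: "'v set \<Rightarrow> 'e set \<Rightarrow> ('e \<Rightarrow> 'v) \<Rightarrow> ('e \<Rightarrow> 'v) \<Rightarrow> bool" where
  "mg_tree V E s t \<longleftrightarrow> mg_connected V E s t \<and> (\<nexists>u ps. mg_cycle E s t u ps)"

text \<open>The edge \<open>(i, x)\<close> joins \<open>x\<close> to \<open>\<phi>\<^sub>i(x)\<close>.\<close>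

definition graphing_edges :: "'i set \<Rightarrow> ('i \<Rightarrow> ('a \<rightharpoonup> 'a)) \<Rightarrow> 'a set \<Rightarrow> ('i \<times> 'a) set" where
  "graphing_edges I \<Phi> C = {(i, x). i \<in> I \<and> x \<in> C \<and> x \<in> dom (\<Phi> i)}"

definition tree_structure :: "'i set \<Rightarrow> ('i \<Rightarrow> ('a \<rightharpoonup> 'a)) \<Rightarrow> 'a set \<Rightarrow> bool" where
  "tree_structure I \<Phi> C \<longleftrightarrow>
     mg_tree C (graphing_edges I \<Phi> C) snd (\<lambda>(i, x). the (\<Phi> i x))"

definition phi1 :: "real \<rightharpoonup> real" where
  "phi1 = (\<lambda>x. Some (inv_into {0..1} thompson_A x)) |` {0..1/2}"

definition phi2 :: "real \<rightharpoonup> real" where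
  "phi2 = (\<lambda>x. Some (inv_into {0..1} thompson_B x)) |` {1/2..3/4}"

definition phi3 :: "real \<rightharpoonup> real" where
  "phi3 = (\<lambda>x. Some (thompson_A x)) |` {3/4..1}"

definition thompson_graphing :: "nat \<Rightarrow> (real \<rightharpoonup> real)" where
  "thompson_graphing i =
     (if i = 1 then phi1 else if i = 2 then phi2 else if i = 3 then phi3 else Map.empty)"

lemma partial_inv_eq_Some_iff:
  assumes "inj_on \<phi> (dom \<phi>)"
  shows "partial_inv \<phi> y = Some x \<longleftrightarrow> \<phi> x = Some y"
proof -
  have u: "x = x'" if "\<phi> x = Some y" "\<phi> x' = Some y" for x x'
    using inj_onD[OF assms, of x x'] that by auto
  have "(THE z. \<phi> z = Some y) = x" if "\<phi> x = Some y" for x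
    using that u by blast
  thus ?thesis by (auto simp: partial_inv_def ran_def)
qed

lemma mg_walk_append:
  "mg_walk E s t u (ps @ qs) v \<longleftrightarrow> (\<exists>x. mg_walk E s t u ps x \<and> mg_walk E s t x qs v)"
  by (induction ps arbitrary: u) auto

lemma mg_walk_rev:
  "mg_walk E s t u ps v \<Longrightarrow> mg_walk E s t v (rev (map (apsnd Not) ps)) u"
  by (induction ps arbitrary: u)
     (auto simp: mg_walk_append step_start_def step_end_def)

lemma word_map_Nil [simp]: "word_map \<Phi> [] = Some"
  by (simp add: word_map_def)

lemma word_map_Cons: "word_map \<Phi> (l # w) = letter_map \<Phi> l \<circ>\<^sub>m word_map \<Phi> w"
  by (simp add: word_map_def)

lemma word_map_append: "word_map \<Phi> (v @ w) = word_map \<Phi> v \<circ>\<^sub>m word_map \<Phi> w"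
  by (induction v) (auto simp: word_map_Cons map_comp_def fun_eq_iff split: option.splits)

lemma ex_reduced_closed_walk_iff_cycle:
  fixes lab :: "'e \<Rightarrow> 'i"
  assumes backtrack: "\<And>a b. a \<in> E \<Longrightarrow> b \<in> E \<Longrightarrow> lab a = lab b \<Longrightarrow> s a = s b \<or> t a = t b \<Longrightarrow> a = b"
  shows "(\<exists>u ps. mg_cycle E s t u ps) \<longleftrightarrow>
     (\<exists>u ps. ps \<noteq> [] \<and> mg_walk E s t u ps u \<and>
        successively (\<lambda>p q. lab (fst p) = lab (fst q) \<longrightarrow> snd p = snd q) ps)"
    (is "_ \<longleftrightarrow> (\<exists>u ps. ?C u ps)")
proof
  assume "\<exists>u ps. mg_cycle E s t u ps"
  then obtain u ps where ps: "ps \<noteq> []" "mg_walk E s t u ps u" "distinct (map fst ps)"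
    by (auto simp: mg_cycle_def)
  have "mg_walk E s t u ps v \<Longrightarrow> distinct (map fst ps) \<Longrightarrow>
     successively (\<lambda>p q. lab (fst p) = lab (fst q) \<longrightarrow> snd p = snd q) ps" for u ps v
  proof (induction ps arbitrary: u)
    case (Cons p ps)
    show ?case
    proof (cases ps)
      case (Cons q qs)
      have "snd p = snd q" if "lab (fst p) = lab (fst q)"
        using Cons.prems that backtrack[of "fst p" "fst q"]
        by (cases "snd p"; cases "snd q")
           (auto simp: Cons step_start_def step_end_def)
      thus ?thesis using Cons.IH Cons.prems by (auto simp: Cons)
    qed simp
  qed simp
  thus "\<exists>u ps. ?C u ps" using ps by blast
next
  assume "\<exists>u ps. ?C u ps"
  then obtain u0 ps0 where "?C u0 ps0" by blast
  hence "\<exists>u. ?C u ps0" by (rule exI[of _ u0])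
  from ex_has_least_nat[of "\<lambda>ps. \<exists>u. ?C u ps", OF this, of length]
  obtain ps where ps: "\<exists>u. ?C u ps" "\<forall>qs. (\<exists>u. ?C u qs) \<longrightarrow> length ps \<le> length qs"
    by blast
  from ps(1) obtain u where C: "?C u ps" by blast
  have min: "length ps \<le> length qs" if "?C v qs" for v qs
    using ps(2) that by blast
  have d1: "distinct (map (step_start s t) ps)"
  proof (rule ccontr)
    assume "\<not> ?thesis"
    then obtain xs ys zs y where "map (step_start s t) ps = xs @ [y] @ ys @ [y] @ zs"
      using not_distinct_decomp by blast
    then obtain as p bs q cs where dec: "ps = as @ p # bs @ q # cs"
       and eq: "step_start s t p = step_start s t q"
      by (fastforce simp: map_eq_append_conv map_eq_Cons_conv append_eq_map_conv Cons_eq_map_conv)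
    have "?C (step_start s t p) (p # bs)"
      using C eq by (auto simp: dec mg_walk_append successively_append_iff successively_Cons)
    from min[OF this] show False by (simp add: dec)
  qed
  have "distinct (map fst ps)"
  proof (rule ccontr)
    assume "\<not> ?thesis"
    then obtain xs ys zs y where "map fst ps = xs @ [y] @ ys @ [y] @ zs"
      using not_distinct_decomp by blast
    then obtain as p bs q cs where dec: "ps = as @ p # bs @ q # cs" and eq: "fst p = fst q"
      by (fastforce simp: map_eq_append_conv map_eq_Cons_conv append_eq_map_conv Cons_eq_map_conv)
    have "step_start s t p \<noteq> step_start s t q" using d1 by (auto simp: dec)
    hence ne: "snd p \<noteq> snd q" using eq by (auto simp: step_start_def split: if_splits)
    hence *: "step_end s t p = step_start s t q"
      using eq by (auto simp: step_start_def step_end_def)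
    show False
    proof (cases bs)
      case Nil
      thus False using C ne eq by (auto simp: dec successively_append_iff)
    next
      case (Cons b bs')
      hence "step_start s t b = step_end s t p" using C by (auto simp: dec mg_walk_append)
      thus False using d1 * by (auto simp: dec Cons)
    qed
  qed
  thus "\<exists>u ps. mg_cycle E s t u ps" using C d1 by (auto simp: mg_cycle_def)
qed

context
  fixes X :: "('a::topological_space) set" and I :: "'i set" and \<Phi> :: "'i \<Rightarrow> ('a \<rightharpoonup> 'a)"
  assumes graphing: "graphing X I \<Phi>"
begin

lemma graphing_inj: "i \<in> I \<Longrightarrow> inj_on (\<Phi> i) (dom (\<Phi> i))"
  using graphing by (auto simp: graphing_def borel_partial_iso_def)

lemma graphing_in_X:
  assumes "i \<in> I" "\<Phi> i x = Some y" shows "x \<in> X" "y \<in> X"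
  using graphing assms by (auto simp: graphing_def borel_partial_iso_def dest: ranI)

lemma graphing_rel_equiv: "equiv X (graphing_rel X I \<Phi>)"
proof -
  have "equiv X (X \<times> X)" by (auto simp: equiv_def refl_on_def sym_def trans_def)
  hence "X \<times> X \<in> {R. equiv X R \<and> (\<forall>i\<in>I. \<forall>x y. \<Phi> i x = Some y \<longrightarrow> (x, y) \<in> R)}"
    using graphing_in_X by auto
  hence sub: "graphing_rel X I \<Phi> \<subseteq> X \<times> X" unfolding graphing_rel_def by blast
  show ?thesis
  proof (rule equivI)
    show "graphing_rel X I \<Phi> \<subseteq> X \<times> X" by (rule sub)
    show "refl_on X (graphing_rel X I \<Phi>)"
      by (auto simp: graphing_rel_def refl_on_def equiv_def)
    show "sym (graphing_rel X I \<Phi>)"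
      by (rule symI) (auto simp: graphing_rel_def equiv_def dest: symD)
    show "trans (graphing_rel X I \<Phi>)"
      by (rule transI) (unfold graphing_rel_def equiv_def, blast dest: transD)
  qed
qed

lemma graphing_rel_step: "i \<in> I \<Longrightarrow> \<Phi> i x = Some y \<Longrightarrow> (x, y) \<in> graphing_rel X I \<Phi>"
  by (auto simp: graphing_rel_def)

lemma graphing_orbit_step:
  assumes "i \<in> I" "\<Phi> i x = Some y"
  shows "x \<in> graphing_orbit X I \<Phi> z \<longleftrightarrow> y \<in> graphing_orbit X I \<Phi> z"
  using graphing_rel_equiv graphing_rel_step[OF assms]
  unfolding graphing_orbit_def equiv_def sym_def trans_def by blast

lemma letter_map_walk_iff:
  assumes "i \<in> I" "u \<in> C"
    and C: "\<And>j x y. j \<in> I \<Longrightarrow> \<Phi> j x = Some y \<Longrightarrow> x \<in> C \<longleftrightarrow> y \<in> C"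
  shows "letter_map \<Phi> (i, d) u = Some v \<longleftrightarrow>
    (\<exists>x. (i, x) \<in> graphing_edges I \<Phi> C \<and>
       u = step_start snd (\<lambda>(i, x). the (\<Phi> i x)) ((i, x), d) \<and>
       v = step_end snd (\<lambda>(i, x). the (\<Phi> i x)) ((i, x), d))"
  using assms(1,2) C[OF assms(1)]
  by (auto simp: letter_map_def graphing_edges_def step_start_def step_end_def
                 partial_inv_eq_Some_iff[OF graphing_inj])

lemma letter_map_in:
  assumes "i \<in> I" "u \<in> C" "letter_map \<Phi> (i, d) u = Some v"
    and C: "\<And>j x y. j \<in> I \<Longrightarrow> \<Phi> j x = Some y \<Longrightarrow> x \<in> C \<longleftrightarrow> y \<in> C"
  shows "v \<in> C"
  using assms(1-3) C[OF assms(1)]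
  by (auto simp: letter_map_def partial_inv_eq_Some_iff[OF graphing_inj] split: if_splits)

lemma word_map_walk_iff:
  assumes "fst ` set w \<subseteq> I" "u \<in> C"
    and C: "\<And>j x y. j \<in> I \<Longrightarrow> \<Phi> j x = Some y \<Longrightarrow> x \<in> C \<longleftrightarrow> y \<in> C"
  shows "word_map \<Phi> (rev w) u = Some v \<longleftrightarrow>
    (\<exists>ps. mg_walk (graphing_edges I \<Phi> C) snd (\<lambda>(i, x). the (\<Phi> i x)) u ps v \<and>
          map (\<lambda>p. (fst (fst p), snd p)) ps = w)"
  using assms(1,2)
proof (induction w arbitrary: u)
  case (Cons l w)
  obtain i d where l: "l = (i, d)" by (cases l)
  have i: "i \<in> I" using Cons.prems by (auto simp: l)
  let ?E = "graphing_edges I \<Phi> C"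
  let ?t = "\<lambda>(i, x). the (\<Phi> i x)"
  have "word_map \<Phi> (rev (l # w)) u = Some v \<longleftrightarrow>
      (\<exists>u'. letter_map \<Phi> (i, d) u = Some u' \<and> word_map \<Phi> (rev w) u' = Some v)"
    by (auto simp: l word_map_append word_map_Cons map_comp_Some_iff)
  also have "\<dots> \<longleftrightarrow> (\<exists>u'. letter_map \<Phi> (i, d) u = Some u' \<and>
      (\<exists>ps. mg_walk ?E snd ?t u' ps v \<and> map (\<lambda>p. (fst (fst p), snd p)) ps = w))"
  proof -
    have "word_map \<Phi> (rev w) u' = Some v \<longleftrightarrow>
      (\<exists>ps. mg_walk ?E snd ?t u' ps v \<and> map (\<lambda>p. (fst (fst p), snd p)) ps = w)"
      if "letter_map \<Phi> (i, d) u = Some u'" for u'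
    proof (rule Cons.IH)
      show "fst ` set w \<subseteq> I" using Cons.prems(1) by simp
      show "u' \<in> C" by (rule letter_map_in[OF i Cons.prems(2) that C])
    qed
    thus ?thesis by blast
  qed
  also have "\<dots> \<longleftrightarrow> (\<exists>x ps. (i, x) \<in> ?E \<and> u = step_start snd ?t ((i, x), d) \<and>
      mg_walk ?E snd ?t (step_end snd ?t ((i, x), d)) ps v \<and>
      map (\<lambda>p. (fst (fst p), snd p)) ps = w)"
  proof -
    have "letter_map \<Phi> (i, d) u = Some u' \<longleftrightarrow>
      (\<exists>x. (i, x) \<in> ?E \<and> u = step_start snd ?t ((i, x), d) \<and>
           u' = step_end snd ?t ((i, x), d))" for u'
      by (rule letter_map_walk_iff[OF i Cons.prems(2)]) (rule C)
    thus ?thesis by (simp only:) blast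
  qed
  also have "\<dots> \<longleftrightarrow> (\<exists>qs. mg_walk ?E snd ?t u qs v \<and>
      map (\<lambda>p. (fst (fst p), snd p)) qs = l # w)"
    (is "?A \<longleftrightarrow> ?B")
  proof
    assume ?A
    then obtain x ps where "(i, x) \<in> ?E" "u = step_start snd ?t ((i, x), d)"
      "mg_walk ?E snd ?t (step_end snd ?t ((i, x), d)) ps v"
      "map (\<lambda>p. (fst (fst p), snd p)) ps = w" by blast
    thus ?B by (intro exI[of _ "((i, x), d) # ps"]) (auto simp: l)
  next
    assume ?B
    thus ?A by (fastforce simp: l map_eq_Cons_conv)
  qed
  finally show ?case .
qed auto

lemma graphing_orbit_connected:
  assumes "x \<in> X"
  defines "C \<equiv> graphing_orbit X I \<Phi> x"
  shows "mg_connected C (graphing_edges I \<Phi> C) snd (\<lambda>(i, x). the (\<Phi> i x))"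
proof -
  let ?t = "\<lambda>(i, x). the (\<Phi> i x)"
  define R where "R = {(u, v). u \<in> X \<and> v \<in> X \<and>
    (\<exists>ps. mg_walk (graphing_edges I \<Phi> X) snd ?t u ps v)}"
  have "equiv X R"
  proof (rule equivI)
    show "R \<subseteq> X \<times> X" by (auto simp: R_def)
    show "refl_on X R" by (auto simp: R_def refl_on_def intro: exI[of _ "[]"])
    show "sym R" using mg_walk_rev by (fastforce simp: R_def sym_def)
    show "trans R" using mg_walk_append by (fastforce simp: R_def trans_def)
  qed
  moreover have "(y, z) \<in> R" if "i \<in> I" "\<Phi> i y = Some z" for i y z
    using graphing_in_X[OF that] that
    by (auto simp: R_def graphing_edges_def step_start_def step_end_def
             intro!: exI[of _ "[((i, y), True)]"])
  ultimately have sub: "graphing_rel X I \<Phi> \<subseteq> R" unfolding graphing_rel_def by blast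
  have stay: "mg_walk (graphing_edges I \<Phi> C) snd ?t u ps v"
    if "mg_walk (graphing_edges I \<Phi> X) snd ?t u ps v" "u \<in> C" for u ps v
    using that
  proof (induction ps arbitrary: u)
    case (Cons p ps)
    obtain i y d where p: "p = ((i, y), d)" by (metis surj_pair)
    obtain z where z: "i \<in> I" "\<Phi> i y = Some z"
      using Cons.prems by (auto simp: p graphing_edges_def)
    have "y \<in> C \<longleftrightarrow> z \<in> C" unfolding C_def by (rule graphing_orbit_step[OF z])
    hence "y \<in> C" "z \<in> C" using Cons.prems z by (auto simp: p step_start_def split: if_splits)
    thus ?case using Cons z
      by (auto simp: p graphing_edges_def step_start_def step_end_def)
  qed simp
  have "x \<in> C" using graphing_rel_equiv assms(1)
    by (auto simp: C_def graphing_orbit_def equiv_def refl_on_def)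
  moreover have "\<exists>ps. mg_walk (graphing_edges I \<Phi> C) snd ?t u ps v" if "u \<in> C" "v \<in> C" for u v
  proof -
    have "(u, v) \<in> graphing_rel X I \<Phi>"
      using graphing_rel_equiv that
      unfolding C_def graphing_orbit_def equiv_def sym_def trans_def by blast
    then obtain ps where "mg_walk (graphing_edges I \<Phi> X) snd ?t u ps v"
      using sub by (auto simp: R_def)
    thus ?thesis using stay that by blast
  qed
  ultimately show ?thesis by (auto simp: mg_connected_def)
qed

theorem tree_structure_iff_no_reduced_word:
  assumes "x \<in> X"
  shows "tree_structure I \<Phi> (graphing_orbit X I \<Phi> x) \<longleftrightarrow>
    (\<forall>w y. reduced_word I w \<longrightarrow> y \<in> graphing_orbit X I \<Phi> x \<longrightarrow> word_map \<Phi> w y \<noteq> Some y)"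
proof -
  define C where "C = graphing_orbit X I \<Phi> x"
  let ?E = "graphing_edges I \<Phi> C"
  let ?t = "\<lambda>(i, x). the (\<Phi> i x)"
  let ?f = "\<lambda>p :: ('i \<times> 'a) \<times> bool. (fst (fst p), snd p)"
  let ?Q = "\<lambda>k l :: 'i \<times> bool. fst k = fst l \<longrightarrow> snd k = snd l"
  have C: "y \<in> C \<longleftrightarrow> z \<in> C" if "j \<in> I" "\<Phi> j y = Some z" for j y z
    unfolding C_def by (rule graphing_orbit_step[OF that])
  have backtrack: "a = b" 
    if ab_E: "a \<in> ?E" "b \<in> ?E" "fst a = fst b" "snd a = snd b \<or> ?t a = ?t b" for a b
  proof -
    obtain i y z where ab: "a = (i, y)" "b = (i, z)" using ab_E(3) by (metis prod.collapse)
    have "i \<in> I" "y \<in> dom (\<Phi> i)" "z \<in> dom (\<Phi> i)" "y = z \<or> \<Phi> i y = \<Phi> i z"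
      using ab_E by (auto simp: ab graphing_edges_def)
    thus ?thesis using inj_onD[OF graphing_inj, of i y z] by (auto simp: ab)
  qed
  have mem: "fst ` set (map ?f ps) \<subseteq> I \<and> (ps \<noteq> [] \<longrightarrow> u \<in> C)" if "mg_walk ?E snd ?t u ps v" for u ps v
    using that
  proof (induction ps arbitrary: u)
    case (Cons p ps)
    obtain i y d where p: "p = ((i, y), d)" by (metis surj_pair)
    obtain z where z: "i \<in> I" "\<Phi> i y = Some z" "y \<in> C"
      using Cons.prems by (auto simp: p graphing_edges_def)
    show ?case using Cons.IH Cons.prems z C[OF z(1,2)]
      by (auto simp: p step_start_def)
  qed simp
  have "(\<exists>u ps. mg_cycle ?E snd ?t u ps) \<longleftrightarrow>
      (\<exists>u ps. ps \<noteq> [] \<and> mg_walk ?E snd ?t u ps u \<and> successively ?Q (map ?f ps))"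
    unfolding successively_map fst_conv snd_conv
    by (rule ex_reduced_closed_walk_iff_cycle) (rule backtrack)
  also have "\<dots> \<longleftrightarrow> (\<exists>u w. w \<noteq> [] \<and> fst ` set w \<subseteq> I \<and> successively ?Q w \<and> u \<in> C \<and>
      word_map \<Phi> (rev w) u = Some u)" (is "?A \<longleftrightarrow> ?B")
  proof
    assume ?A
    then obtain u ps where ps: "ps \<noteq> []" "mg_walk ?E snd ?t u ps u" "successively ?Q (map ?f ps)"
      by blast
    have "word_map \<Phi> (rev (map ?f ps)) u = Some u"
    proof (subst word_map_walk_iff[where C = C])
      show "fst ` set (map ?f ps) \<subseteq> I" "u \<in> C" using mem[OF ps(2)] ps(1) by blast+
      show "\<exists>qs. mg_walk ?E snd ?t u qs u \<and> map ?f qs = map ?f ps" using ps(2) by blast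
    qed (rule C)
    thus ?B using mem[OF ps(2)] ps by (intro exI[of _ u] exI[of _ "map ?f ps"]) auto
  next
    assume ?B
    then obtain u w where w: "w \<noteq> []" "fst ` set w \<subseteq> I" "successively ?Q w" "u \<in> C"
      "word_map \<Phi> (rev w) u = Some u" by blast
    from w(5) obtain ps where "mg_walk ?E snd ?t u ps u" "map ?f ps = w"
    proof (subst (asm) word_map_walk_iff[OF w(2,4)])
    qed (use C in blast)+
    thus ?A using w by auto
  qed
  also have "\<dots> \<longleftrightarrow> (\<exists>u w. reduced_word I w \<and> u \<in> C \<and> word_map \<Phi> w u = Some u)" (is "?A \<longleftrightarrow> ?B")
  proof -
    have Q: "(\<lambda>k l. ?Q l k) = ?Q" by (auto simp: fun_eq_iff)
    have *: "reduced_word I (rev w) \<longleftrightarrow> w \<noteq> [] \<and> fst ` set w \<subseteq> I \<and> successively ?Q w" for w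
      by (simp only: reduced_word_def successively_rev Q set_rev rev_is_Nil_conv)
    show ?thesis
    proof
      assume ?A thus ?B using * by blast
    next
      assume ?B
      then obtain u w where "reduced_word I (rev (rev w))" "u \<in> C"
        "word_map \<Phi> (rev (rev w)) u = Some u" by (simp only: rev_rev_ident) blast
      thus ?A using * by blast
    qed
  qed
  finally show ?thesis
    using graphing_orbit_connected[OF assms]
    unfolding tree_structure_def mg_tree_def C_def[symmetric] by blast
qed

end

lemma thompson_A_inj: "inj_on thompson_A {0..1}"
  by (rule inj_onI) (auto simp: thompson_A_def split: if_splits)

lemma thompson_B_inj: "inj_on thompson_B {0..1}"
  by (rule inj_onI) (auto simp: thompson_B_def split: if_splits)

lemma phi1_eq:
  "phi1 x = (if 0 \<le> x \<and> x \<le> 1/4 then Some (2*x)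
             else if 1/4 \<le> x \<and> x \<le> 1/2 then Some (x + 1/4) else None)"
proof -
  have "inv_into {0..1} thompson_A x = (if x \<le> 1/4 then 2*x else x + 1/4)" if "x \<in> {0..1/2}"
    using that by (intro inv_into_f_eq[OF thompson_A_inj]) (auto simp: thompson_A_def)
  thus ?thesis by (auto simp: phi1_def restrict_map_def)
qed

lemma phi2_eq:
  "phi2 x = (if 1/2 \<le> x \<and> x \<le> 5/8 then Some (2*x - 1/2)
             else if 5/8 \<le> x \<and> x \<le> 3/4 then Some (x + 1/8) else None)"
proof -
  have "inv_into {0..1} thompson_B x = (if x \<le> 5/8 then 2*x - 1/2 else x + 1/8)"
    if "x \<in> {1/2..3/4}"
    using that by (intro inv_into_f_eq[OF thompson_B_inj]) (auto simp: thompson_B_def field_simps)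
  thus ?thesis by (auto simp: phi2_def restrict_map_def)
qed

lemma phi3_eq: "phi3 x = (if 3/4 \<le> x \<and> x \<le> 1 then Some (2*x - 1) else None)"
  by (auto simp: phi3_def restrict_map_def thompson_A_def)

lemma dom_phi: "dom phi1 = {0..1/2}" "dom phi2 = {1/2..3/4}" "dom phi3 = {3/4..1}"
  by (auto simp: phi1_def phi2_def phi3_def)

lemma ran_phi1: "ran phi1 = {0..3/4}"
proof (intro equalityI subsetI)
  fix y assume "y \<in> {0..3/4::real}"
  hence "phi1 (if y \<le> 1/2 then y/2 else y - 1/4) = Some y" by (auto simp: phi1_eq)
  thus "y \<in> ran phi1" by (rule ranI)
qed (auto simp: ran_def phi1_eq split: if_splits)

lemma ran_phi2: "ran phi2 = {1/2..7/8}"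
proof (intro equalityI subsetI)
  fix y assume "y \<in> {1/2..7/8::real}"
  hence "phi2 (if y \<le> 3/4 then y/2 + 1/4 else y - 1/8) = Some y" by (auto simp: phi2_eq)
  thus "y \<in> ran phi2" by (rule ranI)
qed (auto simp: ran_def phi2_eq split: if_splits)

lemma ran_phi3: "ran phi3 = {1/2..1}"
proof (intro equalityI subsetI)
  fix y assume "y \<in> {1/2..1::real}"
  hence "phi3 (y/2 + 1/2) = Some y" by (auto simp: phi3_eq field_simps)
  thus "y \<in> ran phi3" by (rule ranI)
qed (auto simp: ran_def phi3_eq split: if_splits)

lemma inj_phi:
  "inj_on phi1 (dom phi1)" "inj_on phi2 (dom phi2)" "inj_on phi3 (dom phi3)"
  by (rule inj_onI; auto simp: phi1_eq phi2_eq phi3_eq split: if_splits)+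

lemma borel_partial_iso_phi:
  "borel_partial_iso {0..1} phi1" "borel_partial_iso {0..1} phi2" "borel_partial_iso {0..1} phi3"
proof -
  have f1: "(\<lambda>x. the (phi1 x)) \<in> restrict_space borel {0..1/2} \<rightarrow>\<^sub>M borel"
  proof (subst measurable_cong)
    show "(\<lambda>x. if x \<le> 1/4 then 2*x else x + 1/4 :: real) \<in> restrict_space borel {0..1/2} \<rightarrow>\<^sub>M borel"
      by (intro measurable_restrict_space1) measurable
  qed (auto simp: phi1_eq space_restrict_space)
  have f2: "(\<lambda>x. the (phi2 x)) \<in> restrict_space borel {1/2..3/4} \<rightarrow>\<^sub>M borel"
  proof (subst measurable_cong)
    show "(\<lambda>x. if x \<le> 5/8 then 2*x - 1/2 else x + 1/8 :: real)
            \<in> restrict_space borel {1/2..3/4} \<rightarrow>\<^sub>M borel"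
      by (intro measurable_restrict_space1) measurable
  qed (auto simp: phi2_eq space_restrict_space)
  have f3: "(\<lambda>x. the (phi3 x)) \<in> restrict_space borel {3/4..1} \<rightarrow>\<^sub>M borel"
  proof (subst measurable_cong)
    show "(\<lambda>x. 2*x - 1 :: real) \<in> restrict_space borel {3/4..1} \<rightarrow>\<^sub>M borel"
      by (intro measurable_restrict_space1) measurable
  qed (auto simp: phi3_eq space_restrict_space)
  have i1: "partial_inv phi1 y = Some (if y \<le> 1/2 then y/2 else y - 1/4)" if "y \<in> {0..3/4}" for y
    using that unfolding partial_inv_eq_Some_iff[OF inj_phi(1)] by (auto simp: phi1_eq)
  have i2: "partial_inv phi2 y = Some (if y \<le> 3/4 then y/2 + 1/4 else y - 1/8)"
    if "y \<in> {1/2..7/8}" for y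
    using that unfolding partial_inv_eq_Some_iff[OF inj_phi(2)] by (auto simp: phi2_eq)
  have i3: "partial_inv phi3 y = Some (y/2 + 1/2)" if "y \<in> {1/2..1}" for y
    using that unfolding partial_inv_eq_Some_iff[OF inj_phi(3)]
    by (auto simp: phi3_eq field_simps)
  have g1: "(\<lambda>y. the (partial_inv phi1 y)) \<in> restrict_space borel {0..3/4} \<rightarrow>\<^sub>M borel"
  proof (subst measurable_cong)
    show "(\<lambda>y. if y \<le> 1/2 then y/2 else y - 1/4 :: real)
            \<in> restrict_space borel {0..3/4} \<rightarrow>\<^sub>M borel"
      by (intro measurable_restrict_space1) measurable
  qed (auto simp: i1 space_restrict_space)
  have g2: "(\<lambda>y. the (partial_inv phi2 y)) \<in> restrict_space borel {1/2..7/8} \<rightarrow>\<^sub>M borel"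
  proof (subst measurable_cong)
    show "(\<lambda>y. if y \<le> 3/4 then y/2 + 1/4 else y - 1/8 :: real)
            \<in> restrict_space borel {1/2..7/8} \<rightarrow>\<^sub>M borel"
      by (intro measurable_restrict_space1) measurable
  qed (auto simp: i2 space_restrict_space)
  have g3: "(\<lambda>y. the (partial_inv phi3 y)) \<in> restrict_space borel {1/2..1} \<rightarrow>\<^sub>M borel"
  proof (subst measurable_cong)
    show "(\<lambda>y. y/2 + 1/2 :: real) \<in> restrict_space borel {1/2..1} \<rightarrow>\<^sub>M borel"
      by (intro measurable_restrict_space1) measurable
  qed (auto simp: i3 space_restrict_space)
  show "borel_partial_iso {0..1} phi1" "borel_partial_iso {0..1} phi2"
    "borel_partial_iso {0..1} phi3"
    unfolding borel_partial_iso_def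
    using inj_phi f1 f2 f3 g1 g2 g3 by (auto simp: dom_phi ran_phi1 ran_phi2 ran_phi3)
qed

theorem thompson_graphing_is_graphing: "graphing {0..1} {1, 2, 3} thompson_graphing"
  using borel_partial_iso_phi by (auto simp: graphing_def thompson_graphing_def)

end

theory Submission
  imports Defs
begin

text \<open>
  The three domains overlap only in endpoints, so away from the rationals every point has exactly
  one outgoing edge: the graph is that of a map \<open>T\<close>. In such a graph a path without backtracking
  goes forwards first and then backwards, so a closed one yields an equation
  \<open>T\<^sup>m x = T\<^sup>n x\<close> with \<open>m \<noteq> n\<close> (for \<open>m = n\<close> it would turn back along
  the edge it came from). The branches of \<open>T\<close> have rational coefficients and are either expanding
  or translations to the right; hence all periodic points of \<open>T\<close> are rational.
\<close>

definition thompson_map :: "real \<Rightarrow> real" where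
  "thompson_map x =
     (if x \<le> 1/4 then 2*x
      else if x \<le> 1/2 then x + 1/4
      else if x \<le> 5/8 then 2*x - 1/2
      else if x \<le> 3/4 then x + 1/8
      else 2*x - 1)"

text \<open>Where two domains meet, at 1/2 and 3/4, the left one wins, as in
  \<open>thompson_map\<close>; the lemmas that identify the edge at a point assume irrationality and
  so avoid this choice.\<close>

definition branch_index :: "real \<Rightarrow> nat" where
  "branch_index x = (if x \<le> 1/2 then 1 else if x \<le> 3/4 then 2 else 3)"

text \<open>Each branch either doubles or shifts to the right. The sign condition on
  \<open>q\<close> will exclude periodic points of slope 1.\<close>

lemma thompson_map_affine:
  "\<exists>k q. thompson_map x = 2^k * x + q \<and> q \<in> \<rat> \<and> (k = 0 \<longrightarrow> q > 0)"
proof -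
  have "thompson_map x = 2^1 * x + 0 \<or> thompson_map x = 2^0 * x + 1/4 \<or>
        thompson_map x = 2^1 * x + (-1/2) \<or> thompson_map x = 2^0 * x + 1/8 \<or>
        thompson_map x = 2^1 * x + (-1)"
    by (auto simp: thompson_map_def)
  moreover have "1/4 \<in> (\<rat>::real set)" "1/8 \<in> (\<rat>::real set)" "-1/2 \<in> (\<rat>::real set)" "-1 \<in> (\<rat>::real set)"
    by auto
  ultimately show ?thesis
    by (metis Rats_0 zero_less_divide_1_iff zero_less_numeral zero_neq_one)
qed

text \<open>Exponents of the slopes add up, so slope 1 forces every branch along the way to be a
  translation, and positive shifts accumulate.\<close>

lemma thompson_map_funpow_affine:
  "\<exists>k q. (thompson_map ^^ n) x = 2^k * x + q \<and> q \<in> \<rat> \<and> (k = 0 \<longrightarrow> n > 0 \<longrightarrow> q > 0)"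
proof (induction n)
  case 0
  show ?case by (intro exI[of _ 0]) auto
next
  case (Suc n)
  then obtain k q where kq: "(thompson_map ^^ n) x = 2^k * x + q" "q \<in> \<rat>"
    "k = 0 \<longrightarrow> n > 0 \<longrightarrow> q > 0" by blast
  obtain j p where jp: "thompson_map (2^k * x + q) = 2^j * (2^k * x + q) + p" "p \<in> \<rat>"
    "j = 0 \<longrightarrow> p > 0" using thompson_map_affine by blast
  have "(thompson_map ^^ Suc n) x = 2^(j + k) * x + (2^j * q + p)"
    using kq(1) jp(1) by (simp add: distrib_left power_add)
  moreover have "2^j * q + p \<in> \<rat>" using kq jp by auto
  \<comment> \<open>For \<open>n = 0\<close> the induction hypothesis gives no sign, but there
    \<open>k = 0\<close> and \<open>x = x + q\<close> yield \<open>q = 0\<close>.\<close>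
  moreover have "2^j * q + p > 0" if "j + k = 0"
    using that kq jp by (cases "n = 0") auto
  ultimately show ?case by blast
qed

text \<open>Slope 1 would move \<open>x\<close> strictly to the right, so \<open>x\<close> is the
  unique solution of a linear equation with rational coefficients.\<close>

lemma Rats_if_thompson_map_periodic:
  assumes "(thompson_map ^^ n) x = x" "n > 0"
  shows "x \<in> \<rat>"
proof -
  obtain k q where kq: "(thompson_map ^^ n) x = 2^k * x + q" "q \<in> \<rat>" "k = 0 \<longrightarrow> q > 0"
    using thompson_map_funpow_affine assms(2) by blast
  hence "k \<noteq> 0" using assms(1) by (cases "k = 0") auto
  hence "(2::real)^k \<noteq> 1" using one_less_power[of "2::real" k] by force
  hence "x = - q / (2^k - 1)" using kq(1) assms(1) by (simp add: field_simps)
  thus ?thesis using kq(2) by auto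
qed

lemma thompson_map_Rats_iff: "thompson_map x \<in> \<rat> \<longleftrightarrow> x \<in> \<rat>"
proof -
  obtain k q where kq: "thompson_map x = 2^k * x + q" "q \<in> \<rat>"
    using thompson_map_affine by blast
  have "x = (thompson_map x - q) / 2^k" by (simp add: kq)
  moreover have "(2::real)^k \<in> \<rat>" by simp
  ultimately show ?thesis using kq by (metis Rats_add Rats_diff Rats_divide Rats_mult)
qed

lemma thompson_map_funpow_Rats_iff: "(thompson_map ^^ n) x \<in> \<rat> \<longleftrightarrow> x \<in> \<rat>"
  by (induction n) (auto simp: thompson_map_Rats_iff)

text \<open>If the exponents differed, the iterate with the smaller one would be periodic, hence
  rational, and rationality pulls back along iterates to \<open>x\<close>.\<close>

lemma thompson_map_funpow_inj_if_irrational: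
  assumes "x \<notin> \<rat>" "(thompson_map ^^ m) x = (thompson_map ^^ n) x"
  shows "m = n"
proof -
  have *: False if "(thompson_map ^^ m) x = (thompson_map ^^ n) x" "m < n" for m n
  proof -
    have "(thompson_map ^^ (n - m)) ((thompson_map ^^ m) x) = (thompson_map ^^ m) x"
      using that funpow_add[of "n - m" m thompson_map] by simp
    from Rats_if_thompson_map_periodic[OF this] that assms(1) show False
      by (simp add: thompson_map_funpow_Rats_iff)
  qed
  show ?thesis using *[of m n] *[of n m] assms(2) by (metis linorder_neqE_nat)
qed

lemma thompson_graphing_eq_SomeD:
  assumes "thompson_graphing i x = Some y" "x \<notin> \<rat>"
  shows "y = thompson_map x" "i = branch_index x"
proof -
  have "1/2 \<in> (\<rat>::real set)" "3/4 \<in> (\<rat>::real set)" by auto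
  hence "x \<noteq> 1/2" "x \<noteq> 3/4" using assms(2) by metis+
  thus "y = thompson_map x" "i = branch_index x" using assms(1)
    by (auto simp: thompson_graphing_def phi1_eq phi2_eq phi3_eq thompson_map_def branch_index_def
             split: if_splits)
qed

lemma thompson_graphing_Rats_iff:
  assumes "thompson_graphing i x = Some y"
  shows "y \<in> \<rat> \<longleftrightarrow> x \<in> \<rat>"
proof (cases "x \<in> \<rat>")
  case True
  \<comment> \<open>A rational \<open>x\<close> may be an endpoint where the edge does not follow
    \<open>thompson_map\<close>, so the branch formulas are inspected directly.\<close>
  have "y \<in> \<rat>" using assms True
    by (auto simp: thompson_graphing_def phi1_eq phi2_eq phi3_eq split: if_splits)
  thus ?thesis using True by simp
next
  case False
  thus ?thesis using thompson_graphing_eq_SomeD(1)[OF assms] by (simp add: thompson_map_Rats_iff)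
qed

lemma inj_on_thompson_graphing: "inj_on (thompson_graphing i) (dom (thompson_graphing i))"
  using inj_phi by (auto simp: thompson_graphing_def)

lemma letter_map_forward:
  assumes "letter_map thompson_graphing (i, True) x = Some y" "x \<notin> \<rat>"
  shows "y = thompson_map x" "i = branch_index x" "y \<notin> \<rat>"
  using assms thompson_graphing_eq_SomeD[of i x y] by (auto simp: letter_map_def thompson_map_Rats_iff)

text \<open>The traversed edge starts at the result \<open>y\<close>, so \<open>y\<close> determines
  the index; \<open>x\<close> alone does not, as it may have several preimages.\<close>

lemma letter_map_backward:
  assumes "letter_map thompson_graphing (i, False) x = Some y" "x \<notin> \<rat>"
  shows "thompson_map y = x" "i = branch_index y" "y \<notin> \<rat>"
proof -
  have y: "thompson_graphing i y = Some x"
    using assms(1) by (simp add: letter_map_def partial_inv_eq_Some_iff[OF inj_on_thompson_graphing])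
  thus "y \<notin> \<rat>" using thompson_graphing_Rats_iff assms(2) by blast
  thus "thompson_map y = x" "i = branch_index y" using thompson_graphing_eq_SomeD[OF y] by auto
qed

lemma word_map_irrational:
  assumes "word_map thompson_graphing w x = Some y" "x \<notin> \<rat>"
  shows "y \<notin> \<rat>"
  using assms(1)
proof (induction w arbitrary: y)
  case (Cons l w)
  obtain i d where "l = (i, d)" by (cases l)
  thus ?case using Cons letter_map_forward(3) letter_map_backward(3)
    by (cases d) (auto simp: word_map_Cons map_comp_Some_iff)
qed (use assms in auto)

lemma word_map_forward:
  assumes "word_map thompson_graphing w x = Some y" "x \<notin> \<rat>" "\<forall>l\<in>set w. snd l"
  shows "y = (thompson_map ^^ length w) x"
  using assms(1,3)
proof (induction w arbitrary: y)
  case (Cons l w)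
  obtain i z where z: "l = (i, True)" "word_map thompson_graphing w x = Some z"
    "letter_map thompson_graphing (i, True) z = Some y"
    using Cons.prems by (cases l) (auto simp: word_map_Cons map_comp_Some_iff)
  have "z \<notin> \<rat>" using word_map_irrational z(2) assms(2) .
  thus ?case using Cons.IH[OF z(2)] Cons.prems letter_map_forward(1)[OF z(3)] by simp
qed auto

lemma word_map_backward:
  assumes "word_map thompson_graphing w x = Some y" "x \<notin> \<rat>" "\<forall>l\<in>set w. \<not> snd l"
  shows "(thompson_map ^^ length w) y = x"
  using assms(1,3)
proof (induction w arbitrary: y)
  case (Cons l w)
  obtain i z where z: "l = (i, False)" "word_map thompson_graphing w x = Some z"
    "letter_map thompson_graphing (i, False) z = Some y"
    using Cons.prems by (cases l) (auto simp: word_map_Cons map_comp_Some_iff)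
  have "z \<notin> \<rat>" using word_map_irrational z(2) assms(2) .
  thus ?case using Cons.IH[OF z(2)] Cons.prems letter_map_backward(1)[OF z(3)]
    by (simp add: funpow_swap1)
qed auto

text \<open>
  A backward step followed by a forward step must use the same branch, since a point has only one
  outgoing edge. Letters act from right to left, so the forward ones come last in the list.
\<close>

lemma reduced_word_backward_forward:
  assumes "word_map thompson_graphing w x = Some y" "x \<notin> \<rat>"
    and "successively (\<lambda>k l. fst k = fst l \<longrightarrow> snd k = snd l) w"
  shows "\<exists>u v. w = u @ v \<and> (\<forall>l\<in>set u. \<not> snd l) \<and> (\<forall>l\<in>set v. snd l)"
  using assms(1,3)
proof (induction w arbitrary: y)
  case (Cons l w)
  obtain z where z: "word_map thompson_graphing w x = Some z"
    "letter_map thompson_graphing l z = Some y"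
    using Cons.prems by (auto simp: word_map_Cons map_comp_Some_iff)
  obtain u v where uv: "w = u @ v" "\<forall>l\<in>set u. \<not> snd l" "\<forall>l\<in>set v. snd l"
    using Cons.IH[OF z(1)] Cons.prems(2) by (auto simp: successively_Cons)
  show ?case
  proof (cases "snd l")
    case False
    thus ?thesis using uv by (intro exI[of _ "l # u"] exI[of _ v]) auto
  next
    case True
    have "u = []"
    proof (rule ccontr)
      assume "u \<noteq> []"
      then obtain i u' where u: "u = (i, False) # u'"
        using uv(2) by (metis list.set_intros(1) neq_Nil_conv prod.collapse)
      obtain z' where z': "word_map thompson_graphing (u' @ v) x = Some z'"
        "letter_map thompson_graphing (i, False) z' = Some z"
        using z(1) by (auto simp: uv u word_map_Cons map_comp_Some_iff)
      have "z' \<notin> \<rat>" using word_map_irrational z'(1) assms(2) .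
      from letter_map_backward(2,3)[OF z'(2) this] have "i = branch_index z" "z \<notin> \<rat>" .
      moreover have "fst l = branch_index z"
        using letter_map_forward(2)[of "fst l" z y] z(2) True \<open>z \<notin> \<rat>\<close> by (metis prod.collapse)
      ultimately show False using Cons.prems(2) True by (auto simp: uv u)
    qed
    thus ?thesis using uv True by (intro exI[of _ "[]"] exI[of _ "l # v"]) auto
  qed
qed auto

lemma reduced_word_no_irrational_fixpoint:
  assumes "reduced_word I w" "x \<notin> \<rat>"
  shows "word_map thompson_graphing w x \<noteq> Some x"
proof
  assume fixed: "word_map thompson_graphing w x = Some x"
  have red: "w \<noteq> []" "successively (\<lambda>k l. fst k = fst l \<longrightarrow> snd k = snd l) w"
    using assms(1) by (auto simp: reduced_word_def)
  obtain u v where uv: "w = u @ v" "\<forall>l\<in>set u. \<not> snd l" "\<forall>l\<in>set v. snd l"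
    using reduced_word_backward_forward[OF fixed assms(2) red(2)] by blast
  obtain z where z: "word_map thompson_graphing v x = Some z" "word_map thompson_graphing u z = Some x"
    using fixed by (auto simp: uv(1) word_map_append map_comp_Some_iff)
  have irr: "z \<notin> \<rat>" using word_map_irrational z(1) assms(2) .
  have "(thompson_map ^^ length u) x = (thompson_map ^^ length v) x"
    using word_map_backward[OF z(2) irr uv(2)] word_map_forward[OF z(1) assms(2) uv(3)] by simp
  hence len: "length u = length v" using thompson_map_funpow_inj_if_irrational assms(2) by blast
  hence "u \<noteq> []" "v \<noteq> []" using red(1) uv(1) by auto
  \<comment> \<open>These are the two letters that meet at the turning point
    \<open>z\<close>.\<close>
  then obtain i j u' v' where u: "u = u' @ [(i, False)]" and v: "v = (j, True) # v'"
    using uv(2,3)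
    by (metis append_butlast_last_id last_in_set list.set_intros(1) neq_Nil_conv prod.collapse)
  obtain p where p: "word_map thompson_graphing v' x = Some p"
    "letter_map thompson_graphing (j, True) p = Some z"
    using z(1) by (auto simp: v word_map_Cons map_comp_Some_iff)
  obtain q where q: "letter_map thompson_graphing (i, False) z = Some q"
    "word_map thompson_graphing u' q = Some x"
    using z(2) by (auto simp: u word_map_append word_map_Cons map_comp_Some_iff)
  have irr': "p \<notin> \<rat>" "q \<notin> \<rat>"
    using word_map_irrational[OF p(1) assms(2)] letter_map_backward(3)[OF q(1) irr] by auto
  \<comment> \<open>The neighbours of \<open>z\<close> on both sides are the same iterate of
    \<open>x\<close>: \<open>p\<close> is reached forwards from \<open>x\<close>, and
    \<open>q\<close> by retracing \<open>u'\<close> from its end \<open>x\<close>. So both letters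
    use the one edge leaving \<open>p\<close>.\<close>
  have "p = (thompson_map ^^ length v') x" using word_map_forward[OF p(1) assms(2)] uv(3) v by auto
  moreover have "q = (thompson_map ^^ length u') x"
    using word_map_backward[OF q(2) irr'(2)] uv(2) u by auto
  ultimately have "p = q" using len by (simp add: u v)
  hence "i = j" using letter_map_backward(2)[OF q(1) irr] letter_map_forward(2)[OF p(2) irr'(1)] by simp
  thus False using red(2) by (auto simp: uv(1) u v successively_append_iff)
qed

text \<open>The criterion for a tree ranges over all points of the orbit, so irrationality has to
  pass from \<open>x\<close> to each of them.\<close>

lemma thompson_orbit_irrational:
  assumes "y \<in> graphing_orbit {0..1} {1, 2, 3} thompson_graphing x" "x \<notin> \<rat>"
  shows "y \<notin> \<rat>"
proof -
  \<comment> \<open>Agreement in rationality is an equivalence containing all edges, hence it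
    contains the smallest such relation.\<close>
  let ?R = "{(x, y). x \<in> {0..1} \<and> y \<in> {0..1::real} \<and> (x \<in> \<rat> \<longleftrightarrow> y \<in> \<rat>)}"
  have "equiv {0..1} ?R"
    by (rule equivI) (auto simp: refl_on_def sym_def trans_def)
  moreover have "(a, b) \<in> ?R" if "i \<in> {1, 2, 3}" "thompson_graphing i a = Some b" for i a b
    using graphing_in_X[OF thompson_graphing_is_graphing that] thompson_graphing_Rats_iff[OF that(2)]
    by auto
  ultimately have "graphing_rel {0..1} {1, 2, 3} thompson_graphing \<subseteq> ?R"
    unfolding graphing_rel_def by blast
  thus ?thesis using assms by (auto simp: graphing_orbit_def)
qed

lemma Rats_null_sets_lebesgue: "(\<rat> :: real set) \<in> null_sets lebesgue"
  using countable_imp_null_set_lborel[OF countable_rat] by (rule null_sets_completionI)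

theorem theorem3p2:
  shows "(\<forall>\<omega>. reduced_word {1, 2, 3} \<omega> \<longrightarrow>
            {x \<in> {0..1}. word_map thompson_graphing \<omega> x = Some x} \<in> null_sets lebesgue) \<and>
         (AE x in lebesgue_on {0..1}.
            tree_structure {1, 2, 3} thompson_graphing
              (graphing_orbit {0..1} {1, 2, 3} thompson_graphing x))"
proof (intro conjI allI impI)
  fix \<omega> :: "(nat \<times> bool) list"
  assume "reduced_word {1, 2, 3} \<omega>"
  hence "{x \<in> {0..1}. word_map thompson_graphing \<omega> x = Some x} \<subseteq> \<rat>"
    using reduced_word_no_irrational_fixpoint by auto
  thus "{x \<in> {0..1}. word_map thompson_graphing \<omega> x = Some x} \<in> null_sets lebesgue"
    by (rule null_sets_completion_subset[OF _ Rats_null_sets_lebesgue])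
next
  \<comment> \<open>The rationals serve as one exceptional set for all words and all points of the
    orbit at once.\<close>
  have "tree_structure {1, 2, 3} thompson_graphing
      (graphing_orbit {0..1} {1, 2, 3} thompson_graphing x)" if "x \<in> {0..1}" "x \<notin> \<rat>" for x
    unfolding tree_structure_iff_no_reduced_word[OF thompson_graphing_is_graphing that(1)]
    using reduced_word_no_irrational_fixpoint thompson_orbit_irrational that(2) by blast
  moreover have "AE x in lebesgue. x \<notin> (\<rat> :: real set)"
    using Rats_null_sets_lebesgue by (rule AE_not_in)
  ultimately show "AE x in lebesgue_on {0..1}.
      tree_structure {1, 2, 3} thompson_graphing
        (graphing_orbit {0..1} {1, 2, 3} thompson_graphing x)"
    by (subst AE_restrict_space_iff) auto
qed

end
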